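(* Let $q$ be a complex number with $0<|q|<1$, let $n\ge0$ be an integer, and let $a\neq0$, $c$, $u$, $y$ be complex numbers such that no denominator below vanishes and all series below converge absolutely. Then $$\sum_{k=0}^{n}\frac{(q^{-n},a;q)_{k}}{(c;q)_{k}(q;q)_{k}}\;{}_{1}\Phi_{1}\left(\begin{array}{c}q^{k}\\ q^{k}c\end{array};q,uq^{-1},-y\right)q^k =a^n\frac{(c/a;q)_{n}}{(c;q)_{n}}\sum_{i=0}^{n}(uq)^{\binom{i}{2}}\begin{bmatrix}n\\ i\end{bmatrix}_{q}\frac{(c;q)_{i}(-a^{-1}y)^i}{(c/a;q)_{i}(q^nc;q)_{i}}\;{}_{1}\Phi_{1}\left(\begin{array}{c}q^n\\ q^{n+i}c\end{array};q,uq^{-1},-u^iy\right).$$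
   Context: Notation: $(x;q)_0=1$, $(x;q)_m=\prod_{j=0}^{m-1}(1-xq^j)$ for $m\ge1$, and $(x_1,\ldots,x_p;q)_m=(x_1;q)_m\cdots(x_p;q)_m$. The $q$-binomial coefficient is $\begin{bmatrix}n\\ i\end{bmatrix}_q=\frac{(q;q)_n}{(q;q)_i(q;q)_{n-i}}$. The deformed basic hypergeometric series ${}_1\Phi_1$ is $${}_1\Phi_1\left(\begin{array}{c}\alpha\\ \beta\end{array};q,w,z\right)=\sum_{m=0}^\infty w^{\binom m2}\frac{(\alpha;q)_m}{(q;q)_m(\beta;q)_m}(-1)^mq^{\binom m2}z^m .$$ *)

theory Defs
  imports Complex_Main
begin

definition qpoch :: "complex \<Rightarrow> complex \<Rightarrow> nat \<Rightarrow> complex" where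
  "qpoch x q m = (\<Prod>j<m. 1 - x * q ^ j)"

(* Meant for i \<le> n only: for i > n the subtraction n - i truncates to 0. *)
definition qbinom :: "complex \<Rightarrow> nat \<Rightarrow> nat \<Rightarrow> complex" where
  "qbinom q n i = qpoch q q n / (qpoch q q i * qpoch q q (n - i))"

definition phi11_term ::
  "complex \<Rightarrow> complex \<Rightarrow> complex \<Rightarrow> complex \<Rightarrow> complex \<Rightarrow> nat \<Rightarrow> complex" where
  "phi11_term \<alpha> \<beta> q w z m =
     w ^ (m choose 2) * (qpoch \<alpha> q m / (qpoch q q m * qpoch \<beta> q m))
       * (- 1) ^ m * q ^ (m choose 2) * z ^ m"

(* The series is meaningful only if it converges and qpoch \<beta> q m never vanishes;
   both are to be assumed wherever phi11 is used. *)
definition phi11 ::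
  "complex \<Rightarrow> complex \<Rightarrow> complex \<Rightarrow> complex \<Rightarrow> complex \<Rightarrow> complex" where
  "phi11 \<alpha> \<beta> q w z = (\<Sum>m. phi11_term \<alpha> \<beta> q w z m)"

end

theory Submission
  imports Defs
begin

text \<open>
  Both sides are power series in \<open>y\<close>, and the identity holds coefficient by coefficient.
  With base \<open>w = u / q\<close> the coefficient of \<open>y ^ m\<close> in the series on the left carries the
  factor \<open>u ^ (m choose 2)\<close>. On the right the \<open>i\<close>-th summand, already multiplied by \<open>y ^ i\<close>,
  contributes through the coefficient \<open>r = m - i\<close> of its series, and since
  \<open>m choose 2 = (i choose 2) + (r choose 2) + i * r\<close> the powers of \<open>u\<close> combine to the same factor.
  So \<open>u\<close> and \<open>y\<close> factor out, and what is left is a transformation between two finite sums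
  (\<open>coefficient_identity\<close>).

  That transformation is two classical summations glued by an interchange of sums. On its right
  side the dependence on \<open>a\<close> is \<open>a ^ n (c/a;q)_n / (c/a;q)_i\<close>, which up to a power of \<open>a\<close> is
  \<open>a ^ (n - i) (c q^i / a; q)_(n - i)\<close>: the closed form of a q-Chu-Vandermonde sum with upper
  parameters \<open>q ^ -(n - i)\<close> and \<open>a\<close> (\<open>q_Chu_Vandermonde\<close>). Expanding it writes the right side
  as a combination of the polynomials \<open>(a;q)_k\<close>. The coefficient of each \<open>(a;q)_k\<close> is then a sum
  over \<open>i\<close> alone, which the q-Pfaff-Saalschuetz formula (\<open>q_Saalschuetz\<close>, with \<open>x = q ^ k\<close> and
  \<open>n - k\<close> in place of \<open>n\<close>) evaluates to the corresponding summand on the left.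
\<close>

section \<open>The q-shifted factorial\<close>

lemma qpoch_0 [simp]: "qpoch x q 0 = 1"
  by (simp add: qpoch_def)

lemma qpoch_Suc: "qpoch x q (Suc m) = qpoch x q m * (1 - x * q ^ m)"
  by (simp add: qpoch_def)

lemma qpoch_Suc_shift: "qpoch x q (Suc m) = (1 - x) * qpoch (x * q) q m"
  unfolding qpoch_def by (subst prod.lessThan_Suc_shift) (simp add: mult.assoc)

lemma qpoch_add: "qpoch x q (m + r) = qpoch x q m * qpoch (x * q ^ m) q r"
  by (induction r) (simp_all add: qpoch_Suc power_add mult.assoc)

lemma qpoch_swap:
  "qpoch x q i * qpoch (x * q ^ i) q k = qpoch x q k * qpoch (x * q ^ k) q i"
  by (metis add.commute qpoch_add)

lemma qpoch_self_nonzero: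
  assumes "norm q < 1"
  shows "qpoch q q m \<noteq> 0"
proof -
  have "q * q ^ j \<noteq> 1" for j
  proof
    assume "q * q ^ j = 1"
    hence "norm q ^ Suc j = 1"
      by (metis norm_one norm_power power_Suc)
    moreover have "norm q ^ Suc j \<le> norm q ^ 1"
      using assms by (intro power_decreasing) auto
    ultimately show False using assms by simp
  qed
  thus ?thesis by (simp add: qpoch_def)
qed

lemma qpoch_inverse_power_eq_0:
  assumes "q \<noteq> 0" "n < k"
  shows "qpoch (inverse (q ^ n)) q k = 0"
  using assms by (auto simp: qpoch_def intro!: bexI[of _ n])

text \<open>
  Reversing the product \<open>(q^-n;q)_k\<close> gives \<open>(q;q)_n / (q;q)_(n - k)\<close> up to sign and a power of
  \<open>q\<close>. Multiplying by \<open>q ^ (n * k)\<close> keeps all exponents natural numbers.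
\<close>
lemma qpoch_inverse_power:
  assumes "q \<noteq> 0" "k \<le> n"
  shows "qpoch (inverse (q ^ n)) q k * qpoch q q (n - k) * q ^ (n * k)
         = (- 1) ^ k * q ^ (k choose 2) * qpoch q q n"
  using assms(2)
proof (induction k)
  case (Suc k)
  define d where "d = n - Suc k"
  have n: "n = Suc (d + k)" using Suc.prems by (simp add: d_def)
  have e: "n - k = Suc d" "n - Suc k = d" by (simp_all add: n)
  have c2: "Suc k choose 2 = (k choose 2) + k" by (simp add: numeral_2_eq_2)
  have f: "(1 - inverse (q ^ n) * q ^ k) * q ^ n = - (q ^ k * (1 - q * q ^ d))"
    using assms(1) by (simp add: n field_simps power_add)
  have "qpoch (inverse (q ^ n)) q (Suc k) * qpoch q q (n - Suc k) * q ^ (n * Suc k)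
      = qpoch (inverse (q ^ n)) q k * qpoch q q d * q ^ (n * k)
        * ((1 - inverse (q ^ n) * q ^ k) * q ^ n)"
    unfolding e qpoch_Suc by (simp add: power_add algebra_simps)
  also have "\<dots> = - (q ^ k * (qpoch (inverse (q ^ n)) q k * qpoch q q (n - k) * q ^ (n * k)))"
    unfolding f e qpoch_Suc by simp
  also have "\<dots> = (- 1) ^ Suc k * q ^ (Suc k choose 2) * qpoch q q n"
    using Suc by (simp add: c2 power_add)
  finally show ?case .
qed (simp add: binomial_eq_0)

section \<open>The q-Chu-Vandermonde sum\<close>

text \<open>
  These are the coefficients of \<open>E ^ k\<close> in the q-difference operator
  \<open>(1 - E) (1 - q^-1 E) \<dots> (1 - q^-(n-1) E)\<close>, where \<open>E\<close> is the shift \<open>f k \<mapsto> f (k + 1)\<close>.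
\<close>
definition qdiff_weight :: "complex \<Rightarrow> nat \<Rightarrow> nat \<Rightarrow> complex" where
  "qdiff_weight q n k = qpoch (inverse (q ^ n)) q k / qpoch q q k * q ^ k"

lemma qdiff_weight_eq_0: "q \<noteq> 0 \<Longrightarrow> n < k \<Longrightarrow> qdiff_weight q n k = 0"
  by (simp add: qdiff_weight_def qpoch_inverse_power_eq_0)

lemma qdiff_weight_Suc_Suc:
  assumes "q \<noteq> 0" and nz: "\<And>m. qpoch q q m \<noteq> 0"
  shows "qdiff_weight q (Suc n) (Suc k)
         = qdiff_weight q n (Suc k) / q ^ Suc k - qdiff_weight q n k / q ^ k"
proof -
  have s: "qpoch (inverse (q ^ Suc n)) q (Suc k)
      = (1 - inverse (q ^ Suc n)) * qpoch (inverse (q ^ n)) q k"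
  proof -
    have "inverse (q ^ Suc n) * q = inverse (q ^ n)" using assms(1) by simp
    thus ?thesis by (simp only: qpoch_Suc_shift)
  qed
  have "1 - q * q ^ k \<noteq> 0" "qpoch q q k \<noteq> 0"
    using nz[of "Suc k"] by (auto simp: qpoch_Suc)
  thus ?thesis
    unfolding qdiff_weight_def s unfolding qpoch_Suc using assms(1)
    by (simp add: divide_simps) (simp add: algebra_simps)
qed

text \<open>
  The factor \<open>1 - E\<close> of the operator is applied first. The remaining factors
  \<open>(1 - q^-1 E) \<dots> (1 - q^-n E)\<close> are the operator of order \<open>n\<close> with \<open>E\<close> replaced by \<open>E / q\<close>,
  whence the division by \<open>q ^ k\<close>.
\<close>
lemma sum_qdiff_weight_Suc:
  assumes "q \<noteq> 0" and nz: "\<And>m. qpoch q q m \<noteq> 0"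
  shows "(\<Sum>k\<le>Suc n. qdiff_weight q (Suc n) k * f k)
         = (\<Sum>k\<le>n. qdiff_weight q n k / q ^ k * (f k - f (Suc k)))"
proof -
  let ?v = "\<lambda>k. qdiff_weight q n k / q ^ k"
  have z: "qdiff_weight q m 0 = 1" for m by (simp add: qdiff_weight_def)
  have "(\<Sum>k\<le>Suc n. qdiff_weight q (Suc n) k * f k)
      = f 0 + (\<Sum>k\<le>n. ?v (Suc k) * f (Suc k)) - (\<Sum>k\<le>n. ?v k * f (Suc k))"
    unfolding sum.atMost_Suc_shift qdiff_weight_Suc_Suc[OF assms]
    by (simp add: z algebra_simps sum_subtractf)
  also have "f 0 + (\<Sum>k\<le>n. ?v (Suc k) * f (Suc k)) = (\<Sum>k\<le>Suc n. ?v k * f k)"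
    unfolding sum.atMost_Suc_shift by (simp add: z)
  also have "\<dots> = (\<Sum>k\<le>n. ?v k * f k)"
    using assms(1) by (simp add: qdiff_weight_eq_0)
  finally show ?thesis by (simp only: right_diff_distrib sum_subtractf)
qed

text \<open>
  The difference \<open>1 - E\<close> maps \<open>(a;q)_k / (c;q)_k\<close> to a constant times
  \<open>q ^ k (a;q)_k / (c q;q)_k\<close>: the same ratio with \<open>c q\<close> for \<open>c\<close>, with a factor \<open>q ^ k\<close> that
  cancels the division in the recursion for the operator. Hence induction on the order. The closed
  form \<open>a ^ n (c/a;q)_n / (c;q)_n\<close> is written with a product that is polynomial in \<open>a\<close>.
\<close>
lemma q_Chu_Vandermonde:
  assumes "q \<noteq> 0" and nz: "\<And>m. qpoch q q m \<noteq> 0" and "\<And>m. qpoch c q m \<noteq> 0"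
  shows "(\<Sum>k\<le>n. qdiff_weight q n k * (qpoch a q k / qpoch c q k))
         = (\<Prod>j<n. a - c * q ^ j) / qpoch c q n"
  using assms(3)
proof (induction n arbitrary: c)
  case 0
  show ?case by (simp add: qdiff_weight_def)
next
  case (Suc n)
  have c1: "1 - c \<noteq> 0" and cq: "qpoch (c * q) q m \<noteq> 0" for m
    using Suc.prems[of "Suc m"] by (auto simp: qpoch_Suc_shift)
  have step: "qpoch a q k / qpoch c q k - qpoch a q (Suc k) / qpoch c q (Suc k)
      = q ^ k * ((a - c) / (1 - c) * (qpoch a q k / qpoch (c * q) q k))" for k
  proof -
    have "qpoch c q k \<noteq> 0" "1 - c * q ^ k \<noteq> 0"
      using Suc.prems[of "Suc k"] by (auto simp: qpoch_Suc)
    hence "qpoch a q k / qpoch c q k - qpoch a q (Suc k) / qpoch c q (Suc k)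
        = q ^ k * (a - c) * qpoch a q k / qpoch c q (Suc k)"
      by (simp add: qpoch_Suc divide_simps) (simp add: algebra_simps)
    thus ?thesis by (simp add: qpoch_Suc_shift)
  qed
  have "(\<Sum>k\<le>Suc n. qdiff_weight q (Suc n) k * (qpoch a q k / qpoch c q k))
      = (a - c) / (1 - c) * (\<Sum>k\<le>n. qdiff_weight q n k * (qpoch a q k / qpoch (c * q) q k))"
    unfolding sum_qdiff_weight_Suc[OF assms(1) nz] step sum_distrib_left
    using assms(1) by (intro sum.cong) simp_all
  also have "\<dots> = (a - c) / (1 - c) * ((\<Prod>j<n. a - c * q * q ^ j) / qpoch (c * q) q n)"
    using Suc.IH[OF cq] by simp
  also have "\<dots> = (\<Prod>j<Suc n. a - c * q ^ j) / qpoch c q (Suc n)"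
    unfolding prod.lessThan_Suc_shift qpoch_Suc_shift by (simp add: mult.assoc)
  finally show ?case .
qed

section \<open>A q-Pfaff-Saalschuetz sum\<close>

text \<open>
  The q-Pascal rule in summed form. It absorbs the two boundary terms, at which
  \<^const>\<open>qbinom\<close> does not vanish as the rule would need.
\<close>
lemma sum_qbinom_Suc:
  assumes nz: "\<And>m. qpoch q q m \<noteq> 0"
  shows "(\<Sum>i\<le>Suc n. qbinom q (Suc n) i * f i)
         = (\<Sum>i\<le>n. qbinom q n i * (q ^ i * f i + f (Suc i)))"
proof -
  have pascal: "qbinom q (Suc n) (Suc i) = q ^ Suc i * qbinom q n (Suc i) + qbinom q n i"
    if "i < n" for i
  proof -
    obtain d where n: "n = Suc (i + d)" using \<open>i < n\<close> less_imp_Suc_add by blast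
    have e: "Suc n - Suc i = Suc d" "n - Suc i = d" "n - i = Suc d" by (simp_all add: n)
    have "qpoch q q i \<noteq> 0" "1 - q * q ^ i \<noteq> 0" "qpoch q q d \<noteq> 0" "1 - q * q ^ d \<noteq> 0"
      using nz[of "Suc i"] nz[of "Suc d"] by (auto simp: qpoch_Suc)
    moreover have "q ^ n = q * (q ^ i * q ^ d)" by (simp add: n power_add)
    ultimately show ?thesis
      unfolding qbinom_def e qpoch_Suc
      by (simp add: divide_simps) (simp add: algebra_simps)
  qed
  have b: "qbinom q m 0 = 1" "qbinom q m m = 1" for m
    using nz by (simp_all add: qbinom_def)
  have "(\<Sum>i\<le>Suc n. qbinom q (Suc n) i * f i)
      = f 0 + (\<Sum>i<n. qbinom q (Suc n) (Suc i) * f (Suc i)) + f (Suc n)"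
    unfolding sum.atMost_Suc_shift
    unfolding lessThan_Suc_atMost[symmetric] sum.lessThan_Suc
    by (simp add: b)
  also have "\<dots> = (f 0 + (\<Sum>i<n. qbinom q n (Suc i) * (q ^ Suc i * f (Suc i))))
      + ((\<Sum>i<n. qbinom q n i * f (Suc i)) + f (Suc n))"
    by (simp add: pascal algebra_simps sum.distrib)
  also have "f 0 + (\<Sum>i<n. qbinom q n (Suc i) * (q ^ Suc i * f (Suc i)))
      = (\<Sum>i\<le>n. qbinom q n i * (q ^ i * f i))"
    unfolding sum.atMost_shift by (simp add: b)
  also have "(\<Sum>i<n. qbinom q n i * f (Suc i)) + f (Suc n) = (\<Sum>i\<le>n. qbinom q n i * f (Suc i))"
    unfolding lessThan_Suc_atMost[symmetric] sum.lessThan_Suc by (simp add: b)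
  finally show ?thesis by (simp add: algebra_simps sum.distrib)
qed

text \<open>
  By the q-binomial theorem this is the coefficient of \<open>z ^ m\<close> in
  \<open>z ^ i (x z; q)_\<infinity> / (z; q)_\<infinity>\<close>. Being 0 for \<open>i > m\<close>, it lets sums over \<open>i\<close> run past \<open>m\<close>,
  and passing from \<open>m\<close> to \<open>m - 1\<close> is the same as passing from \<open>i\<close> to \<open>i + 1\<close>.
\<close>
definition qbinomial_series_coeff :: "complex \<Rightarrow> complex \<Rightarrow> nat \<Rightarrow> nat \<Rightarrow> complex" where
  "qbinomial_series_coeff x q m i =
     (if i \<le> m then qpoch x q (m - i) / qpoch q q (m - i) else 0)"

text \<open>
  For \<open>G z = (x q z; q)_\<infinity> / (z; q)_\<infinity>\<close> one has \<open>(1 - z) G z = (1 - x q z) G (q z)\<close>; comparing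
  coefficients of \<open>z ^ (m - i)\<close> gives this relation.
\<close>
lemma qbinomial_series_coeff_step:
  assumes nz: "\<And>m. qpoch q q m \<noteq> 0"
  shows "q ^ i * (qbinomial_series_coeff (x * q) q m i - qbinomial_series_coeff (x * q) q m (Suc i))
    = q ^ m * (qbinomial_series_coeff (x * q) q m i - x * qbinomial_series_coeff (x * q) q m (Suc i))"
proof (cases "i < m")
  case True
  then obtain r where m: "m = Suc (i + r)" using less_imp_Suc_add by blast
  have e: "m - i = Suc r" "m - Suc i = r" by (simp_all add: m)
  have d: "qpoch q q r \<noteq> 0" "1 - q * q ^ r \<noteq> 0"
    using nz[of "Suc r"] by (auto simp: qpoch_Suc)
  have "qpoch (x * q) q (Suc r) / qpoch q q (Suc r) - qpoch (x * q) q r / qpoch q q r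
      = q ^ Suc r * (qpoch (x * q) q (Suc r) / qpoch q q (Suc r)
                       - x * (qpoch (x * q) q r / qpoch q q r))"
    unfolding qpoch_Suc using d by (simp add: divide_simps) (simp add: algebra_simps)
  hence "q ^ i * (qpoch (x * q) q (Suc r) / qpoch q q (Suc r) - qpoch (x * q) q r / qpoch q q r)
      = q ^ m * (qpoch (x * q) q (Suc r) / qpoch q q (Suc r)
                       - x * (qpoch (x * q) q r / qpoch q q r))"
    by (simp add: m power_add mult_ac)
  thus ?thesis using True by (simp add: qbinomial_series_coeff_def e)
next
  case False
  thus ?thesis by (cases "i = m") (simp_all add: qbinomial_series_coeff_def)
qed

text \<open>
  This is the q-Pfaff-Saalschuetz sum for the terminating balanced series with upper parameters
  \<open>q^-n, q^-m, c\<close> and lower parameters \<open>c x, q^(1-n-m) / x\<close>, rewritten without negative powers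
  so that it also makes sense at \<open>x = 0\<close>. Let \<open>S_n(m, x)\<close> be the sum. The q-Pascal rule and the
  functional equation of the q-binomial series give
  \<open>(1 - c x) S_(n+1)(m, x) = (1 - c x q^m) S_n(m, x q) - x (1 - c x q^(n+m)) S_n(m - 1, x q)\<close>,
  and the closed form satisfies the same recursion because
  \<open>(1 - x q^m) - x (1 - q^m) = 1 - x\<close>. In the recursion both \<open>x\<close> and \<open>m\<close> change, so the
  induction is over all of them.
\<close>
lemma q_Saalschuetz:
  assumes nz: "\<And>m. qpoch q q m \<noteq> 0" and "\<And>m. qpoch (c * x) q m \<noteq> 0"
  shows "(\<Sum>i\<le>n. qbinom q n i * ((- x) ^ i * q ^ (i choose 2)
             * qbinomial_series_coeff (x * q ^ n) q m i * (qpoch c q i / qpoch (c * x) q i)))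
         = qpoch x q m * qpoch (c * x * q ^ n) q m / (qpoch q q m * qpoch (c * x) q m)"
  using assms(2)
proof (induction n arbitrary: x m)
  case 0
  thus ?case using nz by (simp add: qbinomial_series_coeff_def qbinom_def binomial_eq_0)
next
  case (Suc n)
  let ?R = "qbinomial_series_coeff (x * q ^ Suc n) q m"
  define E where "E i = qpoch c q i / qpoch (c * x * q) q i" for i
  define t where "t i = qbinom q n i * ((- (x * q)) ^ i * q ^ (i choose 2) * E i)"
    for i
  \<comment> \<open>\<open>S\<close> and \<open>S'\<close> are \<open>S_n(m, x q)\<close> and \<open>S_n(m - 1, x q)\<close>; the latter is 0 when \<open>m = 0\<close>.\<close>
  define S where "S = (\<Sum>i\<le>n. t i * ?R i)"
  define S' where "S' = (\<Sum>i\<le>n. t i * ?R (Suc i))"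
  have cx: "1 - c * x \<noteq> 0" and cxq: "qpoch (c * (x * q)) q k \<noteq> 0"
    and cxk: "1 - c * x * q ^ k \<noteq> 0" for k
    using Suc.prems[of "Suc k"] by (auto simp: qpoch_Suc_shift mult.assoc)
       (use Suc.prems[of "Suc k"] in \<open>auto simp: qpoch_Suc mult.assoc\<close>)
  have rat: "qpoch c q i / qpoch (c * x) q i
      = (1 - c * x * q ^ i) / (1 - c * x) * E i" for i
  proof -
    have e: "(1 - c * x) * qpoch (c * x * q) q i = qpoch (c * x) q i * (1 - c * x * q ^ i)"
      by (metis qpoch_Suc qpoch_Suc_shift)
    have "(1 - c * x * q ^ i) / (1 - c * x) * E i
        = (1 - c * x * q ^ i) * qpoch c q i / ((1 - c * x) * qpoch (c * x * q) q i)"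
      by (simp add: E_def)
    also have "\<dots> = qpoch c q i / qpoch (c * x) q i"
      unfolding e using cxk[of i] by simp
    finally show ?thesis by (rule sym)
  qed
  have rat': "qpoch c q (Suc i) / qpoch (c * x) q (Suc i)
      = (1 - c * q ^ i) / (1 - c * x) * E i" for i
    unfolding qpoch_Suc_shift[of "c * x"] qpoch_Suc[of c] E_def by simp
  have c2: "Suc i choose 2 = (i choose 2) + i" for i by (simp add: numeral_2_eq_2)
  \<comment> \<open>The functional equation trades the factor \<open>q ^ i\<close>, which depends on the summation index, for
    \<open>q ^ m\<close>, which can be pulled out of the sum.\<close>
  have bra: "(1 - c * x * q ^ i) * ?R i - x * (1 - c * q ^ i) * ?R (Suc i)
      = (1 - c * x * q ^ m) * ?R i - x * (1 - c * x * q ^ (n + m)) * ?R (Suc i)" for i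
  proof -
    have "(1 - c * x * q ^ i) * ?R i - x * (1 - c * q ^ i) * ?R (Suc i)
        = ?R i - x * ?R (Suc i) - c * x * (q ^ i * (?R i - ?R (Suc i)))"
      by (simp add: algebra_simps)
    also have "q ^ i * (?R i - ?R (Suc i)) = q ^ m * (?R i - x * q ^ n * ?R (Suc i))"
      using qbinomial_series_coeff_step[OF nz, of i "x * q ^ n" m] by (simp add: mult_ac)
    finally show ?thesis by (simp add: power_add algebra_simps)
  qed
  have "(\<Sum>i\<le>Suc n. qbinom q (Suc n) i * ((- x) ^ i * q ^ (i choose 2) * ?R i
             * (qpoch c q i / qpoch (c * x) q i)))
      = (\<Sum>i\<le>n. t i * ((1 - c * x * q ^ i) * ?R i - x * (1 - c * q ^ i) * ?R (Suc i)) / (1 - c * x))"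
    unfolding sum_qbinom_Suc[OF nz]
  proof (intro sum.cong refl)
    fix i
    have p: "(- (x * q)) ^ i = (- x) ^ i * q ^ i"
      by (simp add: power_mult_distrib[symmetric])
    show "qbinom q n i * (q ^ i * ((- x) ^ i * q ^ (i choose 2) * ?R i
             * (qpoch c q i / qpoch (c * x) q i))
           + (- x) ^ Suc i * q ^ (Suc i choose 2) * ?R (Suc i)
             * (qpoch c q (Suc i) / qpoch (c * x) q (Suc i)))
        = t i * ((1 - c * x * q ^ i) * ?R i - x * (1 - c * q ^ i) * ?R (Suc i)) / (1 - c * x)"
      unfolding rat' unfolding rat unfolding t_def c2 p power_add power_Suc[of "- x"] divide_inverse
      by (simp add: algebra_simps del: inverse_mult_distrib)
  qed
  also have "\<dots> = ((1 - c * x * q ^ m) * S - x * (1 - c * x * q ^ (n + m)) * S') / (1 - c * x)"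
    unfolding bra S_def S'_def sum_distrib_left sum_subtractf[symmetric] sum_divide_distrib
    by (intro sum.cong refl) (simp add: algebra_simps)
  finally have rec: "(\<Sum>i\<le>Suc n. qbinom q (Suc n) i * ((- x) ^ i * q ^ (i choose 2) * ?R i
             * (qpoch c q i / qpoch (c * x) q i)))
      = ((1 - c * x * q ^ m) * S - x * (1 - c * x * q ^ (n + m)) * S') / (1 - c * x)" .
  have S: "S = qpoch (x * q) q m * qpoch (c * x * q ^ Suc n) q m
      / (qpoch q q m * qpoch (c * x * q) q m)"
    using Suc.IH[OF cxq, of m] by (simp add: S_def t_def E_def mult_ac)
  show ?case
  proof (cases m)
    case 0
    have "S' = 0" by (simp add: S'_def qbinomial_series_coeff_def 0)
    thus ?thesis unfolding rec S using cx by (simp add: 0)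
  next
    case (Suc r)
    have "?R (Suc i) = qbinomial_series_coeff (x * q * q ^ n) q r i" for i
      by (simp add: Suc qbinomial_series_coeff_def mult_ac)
    hence S': "S' = qpoch (x * q) q r * qpoch (c * x * q ^ Suc n) q r
        / (qpoch q q r * qpoch (c * x * q) q r)"
      using Suc.IH[OF cxq, of r] by (simp add: S'_def t_def E_def mult_ac)
    have "qpoch q q r \<noteq> 0" "1 - q * q ^ r \<noteq> 0"
      using nz[of "Suc r"] by (auto simp: qpoch_Suc)
    moreover have "qpoch (c * x * q) q r \<noteq> 0" "1 - c * x * q * q ^ r \<noteq> 0"
      using cxq[of "Suc r"] by (auto simp: qpoch_Suc mult.assoc)
    ultimately show ?thesis
      unfolding rec S S' unfolding Suc qpoch_Suc_shift[of x] qpoch_Suc_shift[of "c * x"]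
      unfolding qpoch_Suc using cx
      by (simp add: divide_simps power_add) (simp add: algebra_simps)
  qed
qed

section \<open>The coefficients of the powers of y\<close>

text \<open>
  By \<open>qpoch_inverse_power\<close>, \<open>(q^-n;q)_k\<close> is essentially the q-binomial coefficient of \<open>n\<close> and
  \<open>k\<close>, and this is the q-analogue of the trinomial identity: choosing \<open>i\<close> out of \<open>n\<close> and then \<open>k\<close> out
  of \<open>n - i\<close> is the same as choosing \<open>k\<close> first and then \<open>i\<close> out of \<open>n - k\<close>.
\<close>
lemma qbinom_mult_qpoch_inverse_power:
  assumes "q \<noteq> 0" and nz: "\<And>m. qpoch q q m \<noteq> 0" and "i + k \<le> n"
  shows "qbinom q n i * qpoch (inverse (q ^ (n - i))) q k
         = qpoch (inverse (q ^ n)) q k * (q ^ k) ^ i * qbinom q (n - k) i"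
proof -
  obtain d where n: "n = i + k + d" using assms(3) le_Suc_ex by blast
  have e: "n - i = k + d" "n - k = i + d" "n - k - i = d" by (simp_all add: n)
  let ?s = "(- 1) ^ k * q ^ (k choose 2)"
  have 1: "qpoch (inverse (q ^ (k + d))) q k = ?s * qpoch q q (k + d) / (qpoch q q d * q ^ ((k + d) * k))"
    using qpoch_inverse_power[OF assms(1), of k "k + d"] assms(1) nz[of d]
    by (simp add: field_simps)
  have 2: "qpoch (inverse (q ^ n)) q k = ?s * qpoch q q n / (qpoch q q (i + d) * q ^ (n * k))"
    using qpoch_inverse_power[OF assms(1), of k n] assms(1,3) nz[of "i + d"]
    by (simp add: field_simps e)
  have 3: "q ^ (n * k) = q ^ ((k + d) * k) * (q ^ k) ^ i"
    by (simp add: n algebra_simps flip: power_add power_mult)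
  show ?thesis
    unfolding qbinom_def e 1 2 3 using assms(1) nz by (simp add: field_simps)
qed

text \<open>
  The coefficient of \<open>y ^ m\<close> of the transformation, with the common power of \<open>u\<close> removed. The
  factor depending on \<open>a\<close> is expanded in the polynomials \<open>(a;q)_k\<close> by q-Chu-Vandermonde
  (\<open>vander\<close>), and after interchanging the sums the sum over \<open>i\<close> is evaluated by
  q-Pfaff-Saalschuetz (\<open>saal\<close>).
\<close>
lemma coefficient_identity:
  assumes "q \<noteq> 0" and nz: "\<And>m. qpoch q q m \<noteq> 0" and "a \<noteq> 0"
    and c: "\<And>m. qpoch c q m \<noteq> 0" and ca: "\<And>i. i \<le> n \<Longrightarrow> qpoch (c / a) q i \<noteq> 0"
  shows "(\<Sum>k\<le>n. qpoch (inverse (q ^ n)) q k * qpoch a q k / (qpoch c q k * qpoch q q k)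
             * (qpoch (q ^ k) q m / (qpoch q q m * qpoch (q ^ k * c) q m)) * q ^ k)
       = a ^ n * (qpoch (c / a) q n / qpoch c q n)
         * (\<Sum>i\<le>n. q ^ (i choose 2) * qbinom q n i
              * (qpoch c q i * (- inverse a) ^ i / qpoch (c / a) q i)
              * (qbinomial_series_coeff (q ^ n) q m i / qpoch (q ^ n * c) q m))"
proof -
  let ?R = "qbinomial_series_coeff (q ^ n) q m"
  let ?P = "qpoch (q ^ n * c) q m"
  have cs: "qpoch (c * q ^ i) q k \<noteq> 0" for i k
    using c[of "i + k"] by (simp add: qpoch_add)
  have vander: "a ^ n * (qpoch (c / a) q n / qpoch c q n)
        * (qpoch c q i * (- inverse a) ^ i / qpoch (c / a) q i)
      = (- 1) ^ i * (\<Sum>k\<le>n. qdiff_weight q (n - i) k * (qpoch a q k / qpoch (c * q ^ i) q k))"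
    if i: "i \<le> n" for i
  proof -
    obtain r where n: "n = i + r" using i le_Suc_ex by blast
    have pr: "a ^ r * qpoch (c / a * q ^ i) q r = (\<Prod>j<r. a - c * q ^ i * q ^ j)"
      using \<open>a \<noteq> 0\<close> by (induction r) (simp_all add: qpoch_Suc field_simps)
    \<comment> \<open>The terms with \<open>k > r\<close> vanish; keeping them makes the range of \<open>k\<close> independent of \<open>i\<close>, so
      that the two sums can be interchanged.\<close>
    have "(\<Sum>k\<le>n. qdiff_weight q r k * (qpoch a q k / qpoch (c * q ^ i) q k))
        = (\<Sum>k\<le>r. qdiff_weight q r k * (qpoch a q k / qpoch (c * q ^ i) q k))"
      using \<open>q \<noteq> 0\<close> by (intro sum.mono_neutral_right) (auto simp: n qdiff_weight_eq_0)
    also have "\<dots> = a ^ r * qpoch (c / a * q ^ i) q r / qpoch (c * q ^ i) q r"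
      unfolding pr by (rule q_Chu_Vandermonde[OF \<open>q \<noteq> 0\<close> nz cs])
    finally show ?thesis
      using ca[OF i] c[of i] cs[of i r] \<open>a \<noteq> 0\<close>
      by (simp add: n qpoch_add power_add field_simps flip: power_mult_distrib)
  qed
  have saal: "qpoch (inverse (q ^ n)) q k / qpoch c q k
        * (qpoch (q ^ k) q m / (qpoch q q m * qpoch (q ^ k * c) q m))
      = (\<Sum>i\<le>n. q ^ (i choose 2) * qbinom q n i * (- 1) ^ i * (?R i / ?P)
          * (qpoch (inverse (q ^ (n - i))) q k / qpoch (c * q ^ i) q k))"
    if k: "k \<le> n" for k
  proof -
    obtain r where n: "n = r + k" using k le_Suc_ex add.commute by metis
    \<comment> \<open>For \<open>i > r = n - k\<close> the factor \<open>(q ^ -(n - i); q)_k\<close> is 0.\<close>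
    have "(\<Sum>i\<le>n. q ^ (i choose 2) * qbinom q n i * (- 1) ^ i * (?R i / ?P)
          * (qpoch (inverse (q ^ (n - i))) q k / qpoch (c * q ^ i) q k))
        = (\<Sum>i\<le>r. q ^ (i choose 2) * qbinom q n i * (- 1) ^ i * (?R i / ?P)
          * (qpoch (inverse (q ^ (n - i))) q k / qpoch (c * q ^ i) q k))"
      using \<open>q \<noteq> 0\<close>
      by (intro sum.mono_neutral_right) (auto simp: n qpoch_inverse_power_eq_0)
    also have "\<dots> = (\<Sum>i\<le>r. qpoch (inverse (q ^ n)) q k / (qpoch c q k * ?P)
        * (qbinom q r i * ((- (q ^ k)) ^ i * q ^ (i choose 2) * ?R i
            * (qpoch c q i / qpoch (c * q ^ k) q i))))"
    proof (intro sum.cong refl)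
      fix i assume "i \<in> {..r}"
      hence b: "qbinom q n i * qpoch (inverse (q ^ (n - i))) q k
          = qpoch (inverse (q ^ n)) q k * (q ^ k) ^ i * qbinom q r i"
        using qbinom_mult_qpoch_inverse_power[OF \<open>q \<noteq> 0\<close> nz, of i k n] by (simp add: n)
      have s: "inverse (qpoch (c * q ^ i) q k) = qpoch c q i / (qpoch c q k * qpoch (c * q ^ k) q i)"
        using qpoch_swap[of c q i k] c[of k] cs[of k i] cs[of i k] by (simp add: field_simps)
      have sg: "(- (q ^ k)) ^ i = (- 1) ^ i * (q ^ k) ^ i"
        by (metis mult_minus1 power_mult_distrib)
      have "q ^ (i choose 2) * qbinom q n i * (- 1) ^ i * (?R i / ?P)
          * (qpoch (inverse (q ^ (n - i))) q k / qpoch (c * q ^ i) q k)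
        = q ^ (i choose 2) * (- 1) ^ i * (?R i / ?P)
          * (qbinom q n i * qpoch (inverse (q ^ (n - i))) q k) * inverse (qpoch (c * q ^ i) q k)"
        by (simp add: divide_inverse mult_ac)
      thus "q ^ (i choose 2) * qbinom q n i * (- 1) ^ i * (?R i / ?P)
          * (qpoch (inverse (q ^ (n - i))) q k / qpoch (c * q ^ i) q k)
        = qpoch (inverse (q ^ n)) q k / (qpoch c q k * ?P)
          * (qbinom q r i * ((- (q ^ k)) ^ i * q ^ (i choose 2) * ?R i
            * (qpoch c q i / qpoch (c * q ^ k) q i)))"
        unfolding b s sg by (simp add: mult_ac)
    qed
    also have "\<dots> = qpoch (inverse (q ^ n)) q k / (qpoch c q k * ?P)
        * (qpoch (q ^ k) q m * ?P / (qpoch q q m * qpoch (c * q ^ k) q m))"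
    proof -
      have e: "q ^ k * q ^ r = q ^ n" "c * q ^ k * q ^ r = q ^ n * c"
        by (simp_all add: n power_add mult_ac)
      show ?thesis
        unfolding sum_distrib_left[symmetric]
          q_Saalschuetz[OF nz cs[of k], where n = r and m = m, unfolded e] ..
    qed
    finally show ?thesis
      using cs[of n m] by (simp add: mult_ac)
  qed
  have "(\<Sum>k\<le>n. qpoch (inverse (q ^ n)) q k * qpoch a q k / (qpoch c q k * qpoch q q k)
             * (qpoch (q ^ k) q m / (qpoch q q m * qpoch (q ^ k * c) q m)) * q ^ k)
      = (\<Sum>k\<le>n. qpoch a q k / qpoch q q k * q ^ k * (qpoch (inverse (q ^ n)) q k / qpoch c q k
             * (qpoch (q ^ k) q m / (qpoch q q m * qpoch (q ^ k * c) q m))))"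
    by (simp add: mult_ac)
  also have "\<dots> = (\<Sum>k\<le>n. \<Sum>i\<le>n. q ^ (i choose 2) * qbinom q n i * (?R i / ?P) * ((- 1) ^ i
      * (qdiff_weight q (n - i) k * (qpoch a q k / qpoch (c * q ^ i) q k))))"
  proof (intro sum.cong refl)
    fix k assume "k \<in> {..n}"
    hence k: "k \<le> n" by simp
    show "qpoch a q k / qpoch q q k * q ^ k * (qpoch (inverse (q ^ n)) q k / qpoch c q k
             * (qpoch (q ^ k) q m / (qpoch q q m * qpoch (q ^ k * c) q m)))
        = (\<Sum>i\<le>n. q ^ (i choose 2) * qbinom q n i * (?R i / ?P) * ((- 1) ^ i
            * (qdiff_weight q (n - i) k * (qpoch a q k / qpoch (c * q ^ i) q k))))"
      unfolding saal[OF k] sum_distrib_left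
      by (intro sum.cong refl) (simp add: qdiff_weight_def mult_ac)
  qed
  also have "\<dots> = (\<Sum>i\<le>n. q ^ (i choose 2) * qbinom q n i * (?R i / ?P) * ((- 1) ^ i
      * (\<Sum>k\<le>n. qdiff_weight q (n - i) k * (qpoch a q k / qpoch (c * q ^ i) q k))))"
    by (subst sum.swap) (simp only: sum_distrib_left)
  also have "\<dots> = (\<Sum>i\<le>n. q ^ (i choose 2) * qbinom q n i * (?R i / ?P)
      * (a ^ n * (qpoch (c / a) q n / qpoch c q n)
        * (qpoch c q i * (- inverse a) ^ i / qpoch (c / a) q i)))"
    by (intro sum.cong refl) (simp only: vander atMost_iff)
  finally show ?thesis
    by (simp add: sum_distrib_left mult_ac)
qed

section \<open>Summing the power series in y\<close>

lemma choose_two_add: "(i + r) choose 2 = (i choose 2) + (r choose 2) + i * r" for i r :: nat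
  by (induction r) (simp_all add: numeral_2_eq_2)

text \<open>
  The base \<open>u / q\<close> is chosen so that its binomial power cancels the built-in
  \<open>q ^ (m choose 2)\<close>, and the argument \<open>- z\<close> so that all signs cancel.
\<close>
lemma phi11_term_div_q:
  assumes "q \<noteq> 0"
  shows "phi11_term \<alpha> \<beta> q (u * q powi (- 1)) (- z) m
         = u ^ (m choose 2) * z ^ m * (qpoch \<alpha> q m / (qpoch q q m * qpoch \<beta> q m))"
proof -
  have "(u * q powi (- 1)) ^ (m choose 2) * q ^ (m choose 2) = u ^ (m choose 2)"
  proof -
    have "u * q powi (- 1) * q = u" using assms by (simp add: power_int_minus)
    thus ?thesis by (simp only: power_mult_distrib[symmetric])
  qed
  moreover have "(- 1) ^ m * (- z) ^ m = z ^ m"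
    by (simp flip: power_mult_distrib)
  moreover have "phi11_term \<alpha> \<beta> q (u * q powi (- 1)) (- z) m
      = ((u * q powi (- 1)) ^ (m choose 2) * q ^ (m choose 2)) * ((- 1) ^ m * (- z) ^ m)
        * (qpoch \<alpha> q m / (qpoch q q m * qpoch \<beta> q m))"
    unfolding phi11_term_def by (simp only: mult_ac)
  ultimately show ?thesis by simp
qed

lemma sums_shift_zeros:
  fixes f :: "nat \<Rightarrow> complex"
  assumes "f sums s"
  shows "(\<lambda>m. if m < i then 0 else f (m - i)) sums s"
  by (subst sums_zero_iff_shift[of i, symmetric]) (use assms in auto)

theorem theorem15:
  fixes q a c u y :: complex and n :: nat
  assumes "0 < norm q" and "norm q < 1"
    and "a \<noteq> 0"
    and "\<And>k. k \<le> n \<Longrightarrow> qpoch c q k \<noteq> 0"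
    and "\<And>k m. k \<le> n \<Longrightarrow> qpoch (q ^ k * c) q m \<noteq> 0"
    and "\<And>i. i \<le> n \<Longrightarrow> qpoch (c / a) q i \<noteq> 0"
    and "\<And>i. i \<le> n \<Longrightarrow> qpoch (q ^ n * c) q i \<noteq> 0"
    and "\<And>i m. i \<le> n \<Longrightarrow> qpoch (q ^ (n + i) * c) q m \<noteq> 0"
    and "\<And>k. k \<le> n \<Longrightarrow>
      summable (\<lambda>m. norm (phi11_term (q ^ k) (q ^ k * c) q (u * q powi (- 1)) (- y) m))"
    and "\<And>i. i \<le> n \<Longrightarrow>
      summable (\<lambda>m. norm (phi11_term (q ^ n) (q ^ (n + i) * c) q (u * q powi (- 1)) (- (u ^ i) * y) m))"
  shows "(\<Sum>k=0..n. qpoch (q powi (- int n)) q k * qpoch a q k / (qpoch c q k * qpoch q q k)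
            * phi11 (q ^ k) (q ^ k * c) q (u * q powi (- 1)) (- y) * q ^ k)
       = a ^ n * (qpoch (c / a) q n / qpoch c q n)
         * (\<Sum>i=0..n. (u * q) ^ (i choose 2) * qbinom q n i
              * (qpoch c q i * (- (inverse a) * y) ^ i / (qpoch (c / a) q i * qpoch (q ^ n * c) q i))
              * phi11 (q ^ n) (q ^ (n + i) * c) q (u * q powi (- 1)) (- (u ^ i) * y))"
proof -
  have q: "q \<noteq> 0" using assms(1) by auto
  have nz: "qpoch q q m \<noteq> 0" for m using qpoch_self_nonzero[OF assms(2)] .
  have c: "qpoch c q m \<noteq> 0" for m using assms(5)[of 0 m] by simp
  define L where "L k m = phi11_term (q ^ k) (q ^ k * c) q (u * q powi (- 1)) (- y) m" for k m
  define T where "T i m = phi11_term (q ^ n) (q ^ (n + i) * c) q (u * q powi (- 1)) (- (u ^ i) * y) m"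
    for i m
  define A where "A k = qpoch (q powi (- int n)) q k * qpoch a q k / (qpoch c q k * qpoch q q k)" for k
  define B where "B i = (u * q) ^ (i choose 2) * qbinom q n i
      * (qpoch c q i * (- (inverse a) * y) ^ i / (qpoch (c / a) q i * qpoch (q ^ n * c) q i))" for i
  define K where "K = a ^ n * (qpoch (c / a) q n / qpoch c q n)"
  have lhs: "(\<lambda>m. \<Sum>k\<le>n. A k * L k m * q ^ k) sums
      (\<Sum>k\<le>n. A k * phi11 (q ^ k) (q ^ k * c) q (u * q powi (- 1)) (- y) * q ^ k)"
    unfolding phi11_def
  proof (intro sums_sum sums_mult sums_mult2)
    fix k assume "k \<in> {..n}"
    hence "summable (L k)" unfolding L_def using assms(9) summable_norm_cancel by blast
    thus "L k sums (\<Sum>m. phi11_term (q ^ k) (q ^ k * c) q (u * q powi (- 1)) (- y) m)"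
      unfolding L_def by (rule summable_sums)
  qed
  \<comment> \<open>The \<open>i\<close>-th summand carries \<open>y ^ i\<close>, so its series is delayed by \<open>i\<close> places: both sides are
    then series whose \<open>m\<close>-th terms are multiples of \<open>y ^ m\<close>.\<close>
  have rhs: "(\<lambda>m. K * (\<Sum>i\<le>n. B i * (if m < i then 0 else T i (m - i)))) sums
      (K * (\<Sum>i\<le>n. B i * phi11 (q ^ n) (q ^ (n + i) * c) q (u * q powi (- 1)) (- (u ^ i) * y)))"
    unfolding phi11_def
  proof (intro sums_sum sums_mult sums_shift_zeros)
    fix i assume "i \<in> {..n}"
    hence "summable (T i)" unfolding T_def using assms(10) summable_norm_cancel by blast
    thus "T i sums (\<Sum>m. phi11_term (q ^ n) (q ^ (n + i) * c) q (u * q powi (- 1)) (- (u ^ i) * y) m)"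
      unfolding T_def by (rule summable_sums)
  qed
  have "(\<Sum>k\<le>n. A k * L k m * q ^ k)
      = K * (\<Sum>i\<le>n. B i * (if m < i then 0 else T i (m - i)))" for m
  proof -
    have 1: "(\<Sum>k\<le>n. A k * L k m * q ^ k) = u ^ (m choose 2) * y ^ m *
        (\<Sum>k\<le>n. qpoch (inverse (q ^ n)) q k * qpoch a q k / (qpoch c q k * qpoch q q k)
             * (qpoch (q ^ k) q m / (qpoch q q m * qpoch (q ^ k * c) q m)) * q ^ k)"
      unfolding A_def L_def phi11_term_div_q[OF q]
      by (simp add: sum_distrib_left power_int_minus mult_ac)
    have 2: "B i * (if m < i then 0 else T i (m - i)) = u ^ (m choose 2) * y ^ m *
        (q ^ (i choose 2) * qbinom q n i
              * (qpoch c q i * (- inverse a) ^ i / qpoch (c / a) q i)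
              * (qbinomial_series_coeff (q ^ n) q m i / qpoch (q ^ n * c) q m))" for i
    proof (cases "m < i")
      case False
      then obtain r where m: "m = i + r" using le_Suc_ex not_less by blast
      have "qpoch (q ^ n * c) q m = qpoch (q ^ n * c) q i * qpoch (q ^ (n + i) * c) q r"
        by (simp add: m qpoch_add power_add mult_ac)
      moreover have "T i r = u ^ (r choose 2) * (u ^ i * y) ^ r
          * (qpoch (q ^ n) q r / (qpoch q q r * qpoch (q ^ (n + i) * c) q r))"
        unfolding T_def using phi11_term_div_q[OF q, where z = "u ^ i * y"] by simp
      moreover have "(- inverse a * y) ^ i = (- inverse a) ^ i * y ^ i"
        by (rule power_mult_distrib)
      moreover have "u ^ (m choose 2) = u ^ (i choose 2) * u ^ (r choose 2) * (u ^ i) ^ r"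
        by (simp add: m choose_two_add power_add power_mult)
      ultimately show ?thesis
        by (simp add: B_def m qbinomial_series_coeff_def power_mult_distrib power_add mult_ac)
    qed (simp add: qbinomial_series_coeff_def)
    show ?thesis
      unfolding 1 2 sum_distrib_left[symmetric]
      by (subst coefficient_identity[OF q nz assms(3) c])
         (use assms(6) in \<open>simp_all add: K_def mult_ac\<close>)
  qed
  with lhs rhs have "(\<Sum>k\<le>n. A k * phi11 (q ^ k) (q ^ k * c) q (u * q powi (- 1)) (- y) * q ^ k)
      = K * (\<Sum>i\<le>n. B i * phi11 (q ^ n) (q ^ (n + i) * c) q (u * q powi (- 1)) (- (u ^ i) * y))"
    by (simp add: sums_unique2)
  thus ?thesis by (simp add: A_def B_def K_def atLeast0AtMost)
qed

end
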